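(* Let $x_1,\dots,x_N\in\mathbb{R}^d$ be landmarks and $x_g\in\mathbb{R}^d$ a home location whose home bearing directions $\beta_{g1},\dots,\beta_{gN}$ are consistent and non-degenerate, let $f:[-1,1]\to\mathbb{R}$ satisfy properties (i)–(iii) of the context, and let $\varphi(x)=\sum_{i=1}^N d_i(x)\,f(c_i(x))$. Then all the trajectories of the closed-loop system $$\dot{x}=-\nabla\varphi(x)$$ converge asymptotically to $x_g$.
   Context: For a location $x\in\mathbb{R}^d$ and $i\in\{1,\dots,N\}$: $d_i(x)=\|x_i-x\|$ is the range, $\beta_i(x)=d_i(x)^{-1}(x_i-x)$ is the bearing direction, $\beta_{gi}$ is the home bearing direction, and $c_i(x)=\beta_{gi}^T\beta_i(x)$. The home bearing directions are consistent if there exists $x_g\in\mathbb{R}^d$ with $\beta_{gi}=\beta_i(x_g)$ for all $i$, and non-degenerate if such a point $x_g$ is uniquely determined (the paper states that this holds if and only if there are $N\ge 2$ points non-collinear with $x_g$). The cost $\varphi$ is not defined at the landmarks $x_1,\dots,x_N$. $\nabla\varphi$ denotes the gradient of $\varphi$ with respect to $x$; it is given by $\nabla\varphi=\sum_{i=1}^N\bigl(-f(c_i)\beta_i-\dot f(c_i)(I-\beta_i\beta_i^T)\beta_{gi}\bigr)$. Properties of the reshaping function $f:[-1,1]\to\mathbb{R}$, with $\dot f$ denoting its derivative: (i) $f(1)=0$; (ii) $\dot f(c)\le 0$ and finite for $c=1$, and $\dot f(c)<0$ otherwise; (iii) $f(c)+(1-c)\dot f(c)\le 0$.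
   Formalization: Trajectories are taken to be classical solutions that exist for all t ≥ 0 and avoid the landmarks; some solutions run into a landmark in finite time, where the cost is undefined, so the claim fails for those. *)

theory Defs
  imports "HOL-Analysis.Analysis"
begin

definition bearing :: "real ^ 'd \<Rightarrow> real ^ 'd \<Rightarrow> real ^ 'd" where
  "bearing p x = inverse (dist p x) *\<^sub>R (p - x)"

text \<open>
  Landmarks are \<open>X 1, \<dots>, X N\<close> and home bearing directions are \<open>bg 1, \<dots>, bg N\<close>; other
  indices are irrelevant.  A bearing is not defined at its own landmark (where HOL's division
  makes \<^const>\<open>bearing\<close> zero), so a home location is required to differ from all landmarks.
\<close>

definition home_location ::
    "nat \<Rightarrow> (nat \<Rightarrow> real ^ 'd) \<Rightarrow> (nat \<Rightarrow> real ^ 'd) \<Rightarrow> real ^ 'd \<Rightarrow> bool" where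
  "home_location N X bg y \<longleftrightarrow> (\<forall>i\<in>{1..N}. y \<noteq> X i \<and> bg i = bearing (X i) y)"

definition consistent ::
    "nat \<Rightarrow> (nat \<Rightarrow> real ^ 'd) \<Rightarrow> (nat \<Rightarrow> real ^ 'd) \<Rightarrow> bool" where
  "consistent N X bg \<longleftrightarrow> (\<exists>y. home_location N X bg y)"

definition nondegenerate ::
    "nat \<Rightarrow> (nat \<Rightarrow> real ^ 'd) \<Rightarrow> (nat \<Rightarrow> real ^ 'd) \<Rightarrow> bool" where
  "nondegenerate N X bg \<longleftrightarrow> (\<exists>!y. home_location N X bg y)"

text \<open>
  The derivative \<open>f'\<close> is extended-real valued, because finiteness is demanded only at
  \<open>c = 1\<close>: for instance, \<open>f c = (arccos c)\<^sup>2 / 2\<close> has slope \<open>-\<infinity>\<close> at \<open>c = -1\<close>.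
  At the end points it is the one-sided derivative.  Where \<open>f'\<close> is finite, it is the ordinary
  derivative and continuity of \<open>f\<close> is automatic; where it is infinite, continuity is not implied
  and is therefore listed separately.
\<close>

definition reshaping_function :: "(real \<Rightarrow> real) \<Rightarrow> (real \<Rightarrow> ereal) \<Rightarrow> bool" where
  "reshaping_function f f' \<longleftrightarrow>
     continuous_on {-1..1} f \<and>
     (\<forall>c\<in>{-1..1}. ((\<lambda>y. ereal ((f y - f c) / (y - c))) \<longlongrightarrow> f' c) (at c within {-1..1})) \<and>
     f 1 = 0 \<and>
     f' 1 \<le> 0 \<and> \<bar>f' 1\<bar> \<noteq> \<infinity> \<and> (\<forall>c\<in>{-1..<1}. f' c < 0) \<and>
     (\<forall>c\<in>{-1..1}. ereal (f c) + ereal (1 - c) * f' c \<le> 0)"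

definition cost ::
    "nat \<Rightarrow> (nat \<Rightarrow> real ^ 'd) \<Rightarrow> (nat \<Rightarrow> real ^ 'd) \<Rightarrow> (real \<Rightarrow> real) \<Rightarrow> real ^ 'd \<Rightarrow> real" where
  "cost N X bg f x = (\<Sum>i=1..N. dist (X i) x * f (bg i \<bullet> bearing (X i) x))"

text \<open>
  A trajectory is a classical solution on \<open>[0, \<infinity>)\<close> that stays in the set \<open>D\<close> where \<open>\<phi>\<close> is
  defined.  The right-hand side is the actual gradient of \<open>\<phi>\<close>, which therefore has to exist
  along the trajectory.
\<close>

definition gradient_trajectory ::
    "(real ^ 'd) set \<Rightarrow> (real ^ 'd \<Rightarrow> real) \<Rightarrow> (real \<Rightarrow> real ^ 'd) \<Rightarrow> bool" where
  "gradient_trajectory D \<phi> x \<longleftrightarrow>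
     (\<forall>t\<ge>0. x t \<in> D \<and>
        (\<exists>g. GDERIV \<phi> (x t) :> g \<and> (x has_vector_derivative - g) (at t within {0..})))"

end

theory Submission
  imports Defs
begin

text \<open>
  Write \<open>a\<close> for the home location.  The proof rests on the inequality
  \<open>\<phi> x \<le> (x - a) \<bullet> \<nabla>\<phi> x\<close> (lemma \<open>cost_le_radial_gradient\<close>).  It makes
  \<open>\<parallel>x - a\<parallel>\<^sup>2\<close> decrease along trajectories at a rate of at least \<open>2 \<phi> x\<close>.  With the
  value \<open>0\<close> for the term of a landmark at the landmark itself, \<open>\<phi>\<close> is continuous on the whole
  space, and non-degeneracy makes \<open>a\<close> its only zero, so on a compact shell around \<open>a\<close> this
  rate is bounded away from zero: a trajectory that stayed outside a ball around \<open>a\<close> would drive a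
  squared distance below zero.  As the argument uses values of \<open>\<phi>\<close> and not of \<open>\<nabla>\<phi>\<close>, no
  trajectory can converge to a landmark, where \<open>\<nabla>\<phi>\<close> may have no limit.

  The inequality itself says that \<open>\<phi> (a + s v) / s\<close> does not decrease as \<open>s\<close> grows
  past \<open>1\<close>, which is proved without differentiating any single term.  This matters because
  \<open>f\<close> may have infinite slopes, so that individual terms need not be differentiable where their
  sum is.  Factor a term as
  \<open>d f(c) = d (1 - c) \<cdot> q(c)\<close> with \<open>q(c) = f(c) / (1 - c)\<close>.  Property (iii) says exactly that
  \<open>q\<close> is non-increasing, and moving away from \<open>a\<close> along a ray never turns a bearing towards
  its home bearing, so \<open>c\<close> does not increase and \<open>q(c)\<close> does not decrease.  The other factor
  \<open>d (1 - c) = \<parallel>w\<parallel> - \<beta> \<bullet> w\<close>, where \<open>w\<close> points to the landmark and \<open>\<beta>\<close> is the home bearing,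
  is convex along the ray and vanishes at \<open>a\<close>, so its quotient by \<open>s\<close> does not decrease either.
\<close>

section \<open>Reshaping functions\<close>

lemma reshaping_slope_tendsto:
  assumes "reshaping_function f f'" "c \<in> {-1..1}"
  shows "((\<lambda>y. ereal ((f y - f c) / (y - c))) \<longlongrightarrow> f' c) (at c within {-1..1})"
  using assms unfolding reshaping_function_def by blast

text \<open>
  Property (iii) is the sign condition on the derivative of \<open>f c / (1 - c)\<close>.  Since \<open>f'\<close> may be
  \<open>-\<infinity>\<close>, the mean value theorem is replaced by a last-crossing argument: if the quotient rose
  from \<open>a\<close> to \<open>b\<close>, then after its last crossing of a line of small positive slope it would
  stay above that line, which forces too large a slope of \<open>f\<close> at the crossing point.
\<close>

lemma reshaping_quotient_antimono:
  assumes rf: "reshaping_function f f'" and "-1 \<le> a" "a \<le> b" "b < 1"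
  shows "f b / (1 - b) \<le> f a / (1 - a)"
proof (rule ccontr)
  assume neg: "\<not> ?thesis"
  define q where "q c = f c / (1 - c)" for c
  have "q a < q b" using neg by (simp add: q_def)
  then have "a < b" using \<open>a \<le> b\<close> by (cases "a = b") auto
  define \<epsilon> where "\<epsilon> = (q b - q a) / (2 * (b - a))"
  have "\<epsilon> > 0" using \<open>q a < q b\<close> \<open>a < b\<close> by (simp add: \<epsilon>_def)
  define r where "r c = q c - q a - \<epsilon> * (c - a)" for c
  have "\<epsilon> * (b - a) = (q b - q a) / 2"
    using \<open>a < b\<close> by (simp add: \<epsilon>_def field_simps)
  then have "r b > 0" using \<open>q a < q b\<close> by (simp add: r_def)
  have "continuous_on {a..b} f"
    using rf assms(2-) continuous_on_subset[of "{-1..1}" f "{a..b}"]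
    by (auto simp: reshaping_function_def)
  then have contr: "continuous_on {a..b} r"
    unfolding r_def q_def using \<open>b < 1\<close> by (intro continuous_intros) auto
  define S where "S = {c \<in> {a..b}. r c \<le> 0}"
  have "closed S"
    unfolding S_def using contr by (intro continuous_on_closed_Collect_le continuous_intros) auto
  then have "compact ({a..b} \<inter> S)" by (intro compact_Int_closed) auto
  moreover have "a \<in> {a..b} \<inter> S" using \<open>a < b\<close> by (simp add: S_def r_def)
  ultimately obtain c where c: "c \<in> {a..b} \<inter> S" "\<And>y. y \<in> {a..b} \<inter> S \<Longrightarrow> y \<le> c"
    using compact_attains_sup[of "{a..b} \<inter> S"] by blast
  have "c \<noteq> b" using c(1) \<open>r b > 0\<close> by (auto simp: S_def)
  then have c': "a \<le> c" "c < b" "r c \<le> 0" using c(1) by (auto simp: S_def)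
  have rpos: "r y > 0" if "c < y" "y \<le> b" for y
    using c(2)[of y] that c' by (force simp: S_def)
  \<comment> \<open>Property (iii) bounds the slope of \<open>f\<close> at \<open>c\<close> by \<open>- f c / (1 - c)\<close>; the difference
    quotients to the right exceed this by a fixed amount.\<close>
  define \<kappa> where "\<kappa> = (\<epsilon> * (1 - b) - f c / (1 - c))"
  have slope: "\<kappa> \<le> (f y - f c) / (y - c)" if y: "c < y" "y \<le> b" for y
  proof -
    have "\<epsilon> * (y - c) \<le> q y - q c"
      using rpos[OF y] c' by (simp add: r_def algebra_simps)
    then have "\<epsilon> * (y - c) * (1 - y) \<le> (q y - q c) * (1 - y)"
      using y \<open>b < 1\<close> by (intro mult_right_mono) auto
    moreover have "(q y - q c) * (1 - y) = (f y - f c) + (f c / (1 - c)) * (y - c)"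
    proof -
      have "q y * (1 - y) = f y" "q c * (1 - c) = f c"
        using y c' \<open>b < 1\<close> by (simp_all add: q_def)
      then show ?thesis by (simp add: algebra_simps flip: q_def)
    qed
    moreover have "\<epsilon> * (y - c) * (1 - b) \<le> \<epsilon> * (y - c) * (1 - y)"
      using y \<open>\<epsilon> > 0\<close> by (intro mult_left_mono) auto
    ultimately have "\<kappa> * (y - c) \<le> f y - f c"
      by (simp add: \<kappa>_def algebra_simps)
    then show ?thesis using y by (simp add: field_simps)
  qed
  have "c \<in> {-1..1}" using c' assms by auto
  then have lim: "((\<lambda>y. ereal ((f y - f c) / (y - c))) \<longlongrightarrow> f' c) (at c within {-1..1})"
    and iii: "ereal (f c) + ereal (1 - c) * f' c \<le> 0"
    using rf by (auto simp: reshaping_function_def)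
  have "((\<lambda>y. ereal ((f y - f c) / (y - c))) \<longlongrightarrow> f' c) (at c within {c..b})"
    by (rule tendsto_within_subset[OF lim]) (use c' assms in auto)
  moreover have "\<forall>\<^sub>F y in at c within {c..b}. ereal \<kappa> \<le> ereal ((f y - f c) / (y - c))"
    unfolding eventually_at_filter by (rule always_eventually) (use slope in auto)
  moreover have "at c within {c..b} \<noteq> bot"
    using c' by (simp add: at_within_Icc_at_right)
  ultimately have "ereal \<kappa> \<le> f' c" by (metis tendsto_lowerbound)
  then have "ereal (f c) + ereal (1 - c) * ereal \<kappa> \<le> ereal (f c) + ereal (1 - c) * f' c"
    using c' \<open>b < 1\<close> by (intro add_left_mono ereal_mult_left_mono) auto
  with iii have "ereal (f c) + ereal (1 - c) * ereal \<kappa> \<le> 0" by order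
  then have "f c + (1 - c) * \<kappa> \<le> 0" by simp
  moreover have "f c + (1 - c) * \<kappa> = (1 - c) * (\<epsilon> * (1 - b))"
    using c' \<open>b < 1\<close> by (simp add: \<kappa>_def field_simps)
  moreover have "\<dots> > 0" using c' \<open>b < 1\<close> \<open>\<epsilon> > 0\<close> by simp
  ultimately show False by simp
qed

text \<open>
  As \<open>c\<close> tends to \<open>1\<close>, the non-increasing quotient \<open>f c / (1 - c)\<close> tends to \<open>- f' 1 \<ge> 0\<close>, so
  it is non-negative throughout.
\<close>

lemma reshaping_nonneg:
  assumes rf: "reshaping_function f f'" and c: "c \<in> {-1..1}"
  shows "0 \<le> f c"
proof (cases "c = 1")
  case True
  then show ?thesis using rf by (simp add: reshaping_function_def)
next
  case False
  with c have "c < 1" by simp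
  have f1: "f 1 = 0" "f' 1 \<le> 0"
    using rf unfolding reshaping_function_def by blast+
  have lim: "((\<lambda>y. ereal ((f y - f 1) / (y - 1))) \<longlongrightarrow> f' 1) (at 1 within {-1..1})"
    by (rule reshaping_slope_tendsto[OF rf]) simp
  have "((\<lambda>y. ereal ((f y - f 1) / (y - 1))) \<longlongrightarrow> f' 1) (at 1 within {c..1})"
    by (rule tendsto_within_subset[OF lim]) (use c in auto)
  moreover have "- (f c / (1 - c)) \<le> (f y - f 1) / (y - 1)" if "c \<le> y" "y < 1" for y
  proof -
    have "(f y - f 1) / (y - 1) = - (f y / (1 - y))"
      using that f1 by (simp add: field_simps)
    then show ?thesis using reshaping_quotient_antimono[OF rf, of c y] that c by simp
  qed
  then have "\<forall>\<^sub>F y in at 1 within {c..1}. ereal (- (f c / (1 - c))) \<le> ereal ((f y - f 1) / (y - 1))"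
    unfolding eventually_at_filter by (intro always_eventually) auto
  moreover have "at 1 within {c..1} \<noteq> bot"
    using \<open>c < 1\<close> by (simp add: at_within_Icc_at_left)
  ultimately have "ereal (- (f c / (1 - c))) \<le> f' 1" by (metis tendsto_lowerbound)
  then have "ereal (- (f c / (1 - c))) \<le> 0" using f1 by order
  then show ?thesis using \<open>c < 1\<close> by (simp add: zero_le_divide_iff)
qed

text \<open>
  A zero of \<open>f\<close> to the left of \<open>1\<close> would make the non-increasing, non-negative quotient vanish
  from there on, contradicting \<open>f' < 0\<close>.
\<close>

lemma reshaping_pos:
  assumes rf: "reshaping_function f f'" and c: "c \<in> {-1..<1}"
  shows "0 < f c"
proof (rule ccontr)
  assume "\<not> 0 < f c"
  then have "f c = 0" using reshaping_nonneg[OF rf, of c] c by simp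
  have vanish: "f y = 0" if "c \<le> y" "y < 1" for y
  proof -
    have "f y / (1 - y) \<le> 0"
      using reshaping_quotient_antimono[OF rf, of c y] that c \<open>f c = 0\<close> by simp
    then have "f y \<le> 0" using that by (simp add: divide_le_0_iff)
    then show ?thesis using reshaping_nonneg[OF rf, of y] that c by simp
  qed
  have "f' c < 0" and lim: "((\<lambda>y. ereal ((f y - f c) / (y - c))) \<longlongrightarrow> f' c) (at c within {-1..1})"
    using rf c by (auto simp: reshaping_function_def)
  have "((\<lambda>y. ereal ((f y - f c) / (y - c))) \<longlongrightarrow> f' c) (at c within {c..(c + 1) / 2})"
    by (rule tendsto_within_subset[OF lim]) (use c in auto)
  moreover have "\<forall>\<^sub>F y in at c within {c..(c + 1) / 2}. 0 \<le> ereal ((f y - f c) / (y - c))"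
    unfolding eventually_at_filter
    by (intro always_eventually) (use vanish \<open>f c = 0\<close> in auto)
  moreover have "at c within {c..(c + 1) / 2} \<noteq> bot"
    using c by (simp add: at_within_Icc_at_right)
  ultimately have "0 \<le> f' c" by (metis tendsto_lowerbound)
  with \<open>f' c < 0\<close> show False by simp
qed

section \<open>The cost along rays from the home location\<close>

lemma bearing_eq_sgn: "bearing p x = sgn (p - x)"
  by (simp add: bearing_def sgn_div_norm dist_norm)

lemma cosine_bounds:
  fixes n w :: "'a::real_inner"
  assumes "norm n \<le> 1"
  shows "n \<bullet> sgn w \<in> {-1..1}"
proof -
  have "\<bar>n \<bullet> sgn w\<bar> \<le> norm n * norm (sgn w)" by (rule Cauchy_Schwarz_ineq2)
  also have "\<dots> \<le> 1 * 1" using assms by (intro mult_mono) (auto simp: norm_sgn)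
  finally show ?thesis by auto
qed

text \<open>
  Split \<open>z\<close> into its component \<open>A\<close> along \<open>n\<close> and an orthogonal part of squared length \<open>P\<close>.
  Subtracting \<open>k n\<close> changes only \<open>A\<close>, and the cosine \<open>A / sqrt (A\<^sup>2 + P)\<close> increases with \<open>A\<close>.
\<close>

lemma cosine_subtract_axis_le:
  fixes n z :: "'a::real_inner"
  assumes n: "norm n = 1" and k: "0 \<le> k" and z: "z \<noteq> 0" "z - k *\<^sub>R n \<noteq> 0"
  shows "n \<bullet> sgn (z - k *\<^sub>R n) \<le> n \<bullet> sgn z"
proof -
  define A where "A = n \<bullet> z"
  define B where "B = A - k"
  define P where "P = (norm z)\<^sup>2 - A\<^sup>2"
  have nn: "n \<bullet> n = 1" using n by (simp add: dot_square_norm)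
  have B: "n \<bullet> (z - k *\<^sub>R n) = B" by (simp add: inner_diff_right nn A_def B_def)
  have nz: "(norm z)\<^sup>2 = A\<^sup>2 + P" by (simp add: P_def)
  have nz': "(norm (z - k *\<^sub>R n))\<^sup>2 = B\<^sup>2 + P"
  proof -
    have "(norm (z - k *\<^sub>R n))\<^sup>2 = (norm z)\<^sup>2 - 2 * k * A + k\<^sup>2"
      unfolding power2_norm_eq_inner A_def
      by (simp only: inner_diff_left inner_diff_right inner_scaleR_left inner_scaleR_right
          inner_commute[of z n] nn) (simp add: power2_eq_square algebra_simps)
    then show ?thesis by (simp only: P_def B_def) (simp add: power2_eq_square algebra_simps)
  qed
  have "P \<ge> 0"
    using Cauchy_Schwarz_ineq[of n z] by (simp add: P_def A_def nn power2_norm_eq_inner)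
  have sq: "(B * norm z)\<^sup>2 = B\<^sup>2 * A\<^sup>2 + B\<^sup>2 * P" "(A * norm (z - k *\<^sub>R n))\<^sup>2 = B\<^sup>2 * A\<^sup>2 + A\<^sup>2 * P"
    by (simp_all add: power_mult_distrib nz nz' algebra_simps)
  have "B * norm z \<le> A * norm (z - k *\<^sub>R n)"
  proof (cases "B \<ge> 0")
    case True
    then have "B\<^sup>2 * P \<le> A\<^sup>2 * P" using k \<open>P \<ge> 0\<close> by (intro mult_right_mono power_mono) (auto simp: B_def)
    then have "(B * norm z)\<^sup>2 \<le> (A * norm (z - k *\<^sub>R n))\<^sup>2" unfolding sq by linarith
    moreover have "0 \<le> A" using True k unfolding B_def by linarith
    ultimately show ?thesis by (meson power2_le_imp_le mult_nonneg_nonneg norm_ge_zero)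
  next
    case False
    show ?thesis
    proof (cases "A \<ge> 0")
      case True
      then have "B * norm z \<le> 0" "0 \<le> A * norm (z - k *\<^sub>R n)"
        using False by (simp_all add: mult_nonpos_nonneg)
      then show ?thesis by simp
    next
      case A: False
      then have "\<bar>A\<bar> \<le> \<bar>B\<bar>" using k by (simp add: B_def)
      then have "A\<^sup>2 * P \<le> B\<^sup>2 * P" using \<open>P \<ge> 0\<close> by (intro mult_right_mono) (simp_all add: abs_le_square_iff)
      then have "(- A * norm (z - k *\<^sub>R n))\<^sup>2 \<le> (- B * norm z)\<^sup>2"
        unfolding mult_minus_left power2_minus sq by linarith
      then have "- A * norm (z - k *\<^sub>R n) \<le> - B * norm z"
        by (rule power2_le_imp_le) (use False in \<open>simp add: mult_nonpos_nonneg\<close>)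
      then show ?thesis by simp
    qed
  qed
  then show ?thesis
    using z unfolding sgn_div_norm inner_scaleR_right B A_def[symmetric]
    by (simp add: field_simps)
qed

text \<open>
  Let \<open>w\<close> be the vector from the current location to a landmark that has distance \<open>D\<close> and bearing
  \<open>n\<close> at home.  Scaling the displacement from home by \<open>s\<close> replaces \<open>w\<close> by
  \<open>D n - s (D n - w) = s w - (s - 1) D n\<close>.  The term is a product of \<open>norm w * (1 - c)\<close>, which
  grows at least by the factor \<open>s\<close> by the triangle inequality, and the quotient \<open>f c / (1 - c)\<close>,
  which does not decrease because \<open>c\<close> does not increase.
\<close>

lemma cost_term_superhomogeneous:
  fixes n w :: "'a::real_inner"
  assumes rf: "reshaping_function f f'" and n: "norm n = 1" and s: "1 \<le> s" and D: "0 \<le> D"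
    and w: "w \<noteq> 0" and w': "s *\<^sub>R w - ((s - 1) * D) *\<^sub>R n \<noteq> 0"
  shows "s * (norm w * f (n \<bullet> sgn w))
    \<le> norm (s *\<^sub>R w - ((s - 1) * D) *\<^sub>R n) * f (n \<bullet> sgn (s *\<^sub>R w - ((s - 1) * D) *\<^sub>R n))"
proof -
  define w' where "w' = s *\<^sub>R w - ((s - 1) * D) *\<^sub>R n"
  define c where "c = n \<bullet> sgn w"
  define c' where "c' = n \<bullet> sgn w'"
  have bounds: "c \<in> {-1..1}" "c' \<in> {-1..1}"
    using n by (simp_all only: c_def c'_def cosine_bounds)
  have "n \<bullet> sgn w' \<le> n \<bullet> sgn (s *\<^sub>R w)"
    unfolding w'_def using n s D w w' by (intro cosine_subtract_axis_le) auto
  also have "\<dots> = c" using s by (simp add: c_def sgn_scaleR)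
  finally have "c' \<le> c" by (simp add: c'_def)
  have excess: "norm v * (1 - n \<bullet> sgn v) = norm v - n \<bullet> v" for v
    by (cases "v = 0") (simp_all add: sgn_div_norm field_simps)
  have nn: "n \<bullet> n = 1" using n by (simp add: dot_square_norm)
  have "s * norm w - (s - 1) * D \<le> norm w'"
    using norm_triangle_ineq2[of "s *\<^sub>R w" "((s - 1) * D) *\<^sub>R n"] s D n by (simp add: w'_def)
  then have convex: "s * (norm w * (1 - c)) \<le> norm w' * (1 - c')"
    unfolding c_def c'_def excess
    by (simp add: w'_def inner_diff_right nn algebra_simps)
  have "s * (norm w * f c) \<le> norm w' * f c'"
  proof (cases "c < 1")
    case True
    have "s * (norm w * f c) = s * (norm w * (1 - c)) * (f c / (1 - c))"
      using True by simp
    also have "\<dots> \<le> norm w' * (1 - c') * (f c' / (1 - c'))"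
    proof (rule mult_mono[OF convex])
      show "f c / (1 - c) \<le> f c' / (1 - c')"
        using True bounds \<open>c' \<le> c\<close> by (intro reshaping_quotient_antimono[OF rf]) auto
      show "0 \<le> f c / (1 - c)"
        using True reshaping_nonneg[OF rf bounds(1)] by simp
    qed (use bounds in simp)
    also have "\<dots> = norm w' * f c'"
      using True \<open>c' \<le> c\<close> by simp
    finally show ?thesis .
  next
    case False
    then have "c = 1" using bounds by simp
    then have "f c = 0" using rf by (simp add: reshaping_function_def)
    then show ?thesis using reshaping_nonneg[OF rf bounds(2)] by simp
  qed
  then show ?thesis by (simp add: c_def c'_def w'_def)
qed

lemma cost_superhomogeneous:
  assumes rf: "reshaping_function f f'" and home: "home_location N X bg a" and s: "1 \<le> s"
    and x: "a + v \<notin> X ` {1..N}" and x': "a + s *\<^sub>R v \<notin> X ` {1..N}"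
  shows "s * cost N X bg f (a + v) \<le> cost N X bg f (a + s *\<^sub>R v)"
  unfolding cost_def sum_distrib_left
proof (rule sum_mono)
  fix i assume i: "i \<in> {1..N}"
  define n where "n = bg i"
  define D where "D = norm (X i - a)"
  have "X i \<noteq> a" and n: "n = sgn (X i - a)"
    using home i by (auto simp: home_location_def bearing_eq_sgn n_def)
  then have "norm n = 1" and Dn: "X i - a = D *\<^sub>R n"
    by (simp_all add: norm_sgn D_def sgn_div_norm)
  have ray: "X i - (a + s *\<^sub>R v) = s *\<^sub>R (X i - (a + v)) - ((s - 1) * D) *\<^sub>R n"
  proof -
    have "((s - 1) * D) *\<^sub>R n = (s - 1) *\<^sub>R (X i - a)" by (simp add: Dn)
    then show ?thesis by (simp add: algebra_simps)
  qed
  have "X i - (a + v) \<noteq> 0" "s *\<^sub>R (X i - (a + v)) - ((s - 1) * D) *\<^sub>R n \<noteq> 0"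
    using x x' i unfolding ray[symmetric] by (metis eq_iff_diff_eq_0 imageI)+
  from cost_term_superhomogeneous[OF rf \<open>norm n = 1\<close> s _ this]
  show "s * (dist (X i) (a + v) * f (bg i \<bullet> bearing (X i) (a + v)))
    \<le> dist (X i) (a + s *\<^sub>R v) * f (bg i \<bullet> bearing (X i) (a + s *\<^sub>R v))"
    by (simp add: bearing_eq_sgn dist_norm ray D_def flip: n_def)
qed

text \<open>
  The function \<open>s \<mapsto> \<phi> (a + s v) - s \<phi> (a + v)\<close>, with \<open>v = x - a\<close>, vanishes at \<open>s = 1\<close> and is
  non-negative just to the right of it, so its derivative at \<open>1\<close>, namely \<open>v \<bullet> g - \<phi> x\<close>, cannot
  be negative.
\<close>

lemma cost_le_radial_gradient:
  assumes rf: "reshaping_function f f'" and home: "home_location N X bg a"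
    and x: "x \<notin> X ` {1..N}" and g: "GDERIV (cost N X bg f) x :> g"
  shows "cost N X bg f x \<le> (x - a) \<bullet> g"
proof (rule ccontr)
  define \<phi> where "\<phi> = cost N X bg f"
  define v where "v = x - a"
  define h where "h s = \<phi> (a + s *\<^sub>R v) - s * \<phi> x" for s :: real
  assume "\<not> ?thesis"
  then have neg: "v \<bullet> g - \<phi> x < 0" by (simp add: v_def \<phi>_def)
  have ray: "((\<lambda>s. a + s *\<^sub>R v) has_derivative (\<lambda>k. k *\<^sub>R v)) (at 1)"
    by (auto intro!: derivative_eq_intros)
  have "(\<phi> has_derivative (\<lambda>k. k \<bullet> g)) (at (a + 1 *\<^sub>R v))"
    using g by (simp add: gderiv_def \<phi>_def v_def)
  from has_derivative_compose[OF ray this]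
  have "((\<lambda>s. \<phi> (a + s *\<^sub>R v)) has_real_derivative v \<bullet> g) (at 1)"
    by (simp add: has_field_derivative_def mult_commute_abs)
  then have "(h has_real_derivative v \<bullet> g - \<phi> x) (at 1)"
    unfolding h_def by (auto intro!: derivative_eq_intros)
  from DERIV_neg_dec_right[OF this neg] obtain d where d: "d > 0" "\<And>k. 0 < k \<Longrightarrow> k < d \<Longrightarrow> h (1 + k) < h 1"
    by auto
  have "open (- X ` {1..N})" by (intro open_Compl finite_imp_closed) auto
  moreover have "((\<lambda>k. a + (1 + k) *\<^sub>R v) \<longlongrightarrow> a + (1 + 0) *\<^sub>R v) (at_right 0)"
    by (intro tendsto_intros)
  ultimately have "\<forall>\<^sub>F k in at_right 0. a + (1 + k) *\<^sub>R v \<in> - X ` {1..N}"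
    using x by (intro topological_tendstoD) (auto simp: v_def)
  moreover have "\<forall>\<^sub>F k in at_right 0. k < d"
    using d(1) eventually_at_right_less eventually_at_right_field by blast
  moreover have "\<forall>\<^sub>F k::real in at_right 0. 0 < k" by (rule eventually_at_right_less)
  ultimately have "\<forall>\<^sub>F k in at_right 0. a + (1 + k) *\<^sub>R v \<in> - X ` {1..N} \<and> k < d \<and> 0 < k"
    by eventually_elim auto
  then obtain k where k: "a + (1 + k) *\<^sub>R v \<notin> X ` {1..N}" "k < d" "0 < k"
    using eventually_happens[of _ "at_right (0::real)"] by auto
  have "(1 + k) * \<phi> (a + v) \<le> \<phi> (a + (1 + k) *\<^sub>R v)"
    unfolding \<phi>_def using k x by (intro cost_superhomogeneous[OF rf home]) (auto simp: v_def)
  then have "h 1 \<le> h (1 + k)" by (simp add: h_def v_def)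
  with d(2)[of k] k show False by simp
qed

section \<open>Positivity and continuity of the cost\<close>

lemma norm_home_bearing:
  assumes "home_location N X bg a" "i \<in> {1..N}"
  shows "norm (bg i) = 1"
  using assms by (auto simp: home_location_def bearing_eq_sgn norm_sgn)

lemma cost_term_nonneg:
  assumes rf: "reshaping_function f f'" and home: "home_location N X bg a" and i: "i \<in> {1..N}"
  shows "0 \<le> dist (X i) x * f (bg i \<bullet> bearing (X i) x)"
  unfolding bearing_eq_sgn
  using norm_home_bearing[OF home i]
  by (intro mult_nonneg_nonneg reshaping_nonneg[OF rf] cosine_bounds) auto

text \<open>
  At a zero \<open>y\<close> of the cost, each landmark either equals \<open>y\<close> or is seen in its home direction.
  In both cases it is seen in that direction from the midpoint of \<open>a\<close> and \<open>y\<close>, so the midpoint is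
  a home location.  Passing to the midpoint covers zeros at a landmark, where \<open>y\<close> itself is
  not a candidate for a home location.
\<close>

lemma cost_eq_0_imp_home:
  assumes rf: "reshaping_function f f'" and home: "home_location N X bg a"
    and nondeg: "nondegenerate N X bg" and zero: "cost N X bg f y = 0"
  shows "y = a"
proof -
  define p where "p = midpoint a y"
  have "home_location N X bg p"
    unfolding home_location_def
  proof
    fix i assume i: "i \<in> {1..N}"
    define n where "n = bg i"
    have n1: "norm n = 1" unfolding n_def by (rule norm_home_bearing[OF home i])
    have "X i \<noteq> a" "n = sgn (X i - a)"
      using home i by (auto simp: home_location_def bearing_eq_sgn n_def)
    then have an: "X i - a = norm (X i - a) *\<^sub>R n" by (simp add: sgn_div_norm)
    have yn: "X i - y = norm (X i - y) *\<^sub>R n"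
    proof (cases "X i = y")
      case False
      have "\<forall>i\<in>{1..N}. dist (X i) y * f (bg i \<bullet> bearing (X i) y) = 0"
        using zero cost_term_nonneg[OF rf home]
        by (subst (asm) cost_def, subst (asm) sum_nonneg_eq_0_iff) auto
      then have "f (n \<bullet> sgn (X i - y)) = 0" using i False by (auto simp: bearing_eq_sgn n_def)
      then have "n \<bullet> sgn (X i - y) = 1"
        using reshaping_pos[OF rf, of "n \<bullet> sgn (X i - y)"] cosine_bounds[of n "X i - y"] n1
        by force
      then have "n \<bullet> (X i - y) = norm n * norm (X i - y)"
        using False n1 unfolding sgn_div_norm inner_scaleR_right by (simp add: field_simps)
      then show ?thesis using n1 norm_cauchy_schwarz_eq[of n "X i - y"] by simp
    qed simp
    define \<mu> where "\<mu> = (norm (X i - a) + norm (X i - y)) / 2"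
    have "\<mu> > 0" using \<open>X i \<noteq> a\<close> by (simp add: \<mu>_def add_pos_nonneg)
    have "X i - p = (1 / 2) *\<^sub>R ((X i - a) + (X i - y))"
      by (simp add: p_def midpoint_def vec_eq_iff field_simps)
    also have "\<dots> = \<mu> *\<^sub>R n"
      by (subst an, subst yn) (simp add: \<mu>_def add_divide_distrib flip: scaleR_add_left)
    finally have Xp: "X i - p = \<mu> *\<^sub>R n" .
    then have "p \<noteq> X i" using \<open>\<mu> > 0\<close> n1 by auto
    moreover have "bearing (X i) p = n"
      using \<open>\<mu> > 0\<close> n1 by (simp add: bearing_eq_sgn Xp sgn_scaleR) (simp add: sgn_div_norm)
    ultimately show "p \<noteq> X i \<and> bg i = bearing (X i) p" by (simp add: n_def)
  qed
  then have "p = a" using nondeg home unfolding nondegenerate_def by blast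
  then show ?thesis by (simp add: p_def)
qed

lemma cost_pos:
  assumes rf: "reshaping_function f f'" and home: "home_location N X bg a"
    and nondeg: "nondegenerate N X bg" and "y \<noteq> a"
  shows "0 < cost N X bg f y"
proof -
  have "0 \<le> cost N X bg f y"
    unfolding cost_def by (intro sum_nonneg cost_term_nonneg[OF rf home])
  then show ?thesis using cost_eq_0_imp_home[OF rf home nondeg, of y] \<open>y \<noteq> a\<close> by force
qed

text \<open>
  At the landmark the direction has no limit, but \<open>f\<close> is bounded and the distance tends to zero.
\<close>

lemma isCont_cost_term:
  fixes n p :: "'a::real_inner"
  assumes f: "continuous_on {-1..1} f" and n: "norm n \<le> 1"
  shows "isCont (\<lambda>x. norm (p - x) * f (n \<bullet> sgn (p - x))) y"
proof (cases "p = y")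
  case True
  have "compact (f ` {-1..1})" using f by (intro compact_continuous_image) auto
  then obtain M where M: "\<And>c. c \<in> {-1..1} \<Longrightarrow> \<bar>f c\<bar> \<le> M"
    using compact_imp_bounded[of "f ` {-1..1}"] by (metis bounded_real imageI)
  have "((\<lambda>x. norm (p - x) * f (n \<bullet> sgn (p - x))) \<longlongrightarrow> 0) (at y)"
  proof (rule Lim_null_comparison)
    show "\<forall>\<^sub>F x in at y. norm (norm (p - x) * f (n \<bullet> sgn (p - x))) \<le> norm (p - x) * M"
      using M[OF cosine_bounds[OF n]]
      by (intro always_eventually allI) (auto simp: abs_mult intro!: mult_left_mono)
    have "((\<lambda>x. norm (p - x) * M) \<longlongrightarrow> norm (p - y) * M) (at y)" by (intro tendsto_intros)
    then show "((\<lambda>x. norm (p - x) * M) \<longlongrightarrow> 0) (at y)" using True by simp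
  qed
  then show ?thesis using True by (simp add: isCont_def)
next
  case False
  have "continuous_on (- {p}) (\<lambda>x. norm (p - x) * f (n \<bullet> sgn (p - x)))"
    using cosine_bounds[OF n]
    by (intro continuous_intros continuous_on_compose2[OF f]) auto
  then show ?thesis using False by (simp add: continuous_on_eq_continuous_at open_Compl)
qed

lemma continuous_on_cost:
  assumes rf: "reshaping_function f f'" and home: "home_location N X bg a"
  shows "continuous_on S (cost N X bg f)"
proof (intro continuous_at_imp_continuous_on ballI)
  fix y
  have "continuous_on {-1..1} f" using rf by (simp add: reshaping_function_def)
  then show "isCont (cost N X bg f) y"
    unfolding cost_def bearing_eq_sgn dist_norm
    using norm_home_bearing[OF home] by (intro continuous_sum isCont_cost_term) auto
qed

section \<open>Convergence from radial decay\<close>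

text \<open>
  A Lyapunov argument with the squared distance to \<open>a\<close>.  The decay rate \<open>W\<close> has a positive minimum
  on each compact shell around \<open>a\<close>, so the trajectory enters every ball around \<open>a\<close> in finite
  time; monotonicity of the distance keeps it there.
\<close>

lemma converges_if_radially_decaying:
  fixes x x' :: "real \<Rightarrow> 'a::euclidean_space"
  assumes deriv: "\<And>t. t \<ge> 0 \<Longrightarrow> (x has_vector_derivative x' t) (at t within {0..})"
    and decay: "\<And>t. t \<ge> 0 \<Longrightarrow> (x t - a) \<bullet> x' t \<le> - W (x t)"
    and cont: "continuous_on UNIV W" and pos: "\<And>y. y \<noteq> a \<Longrightarrow> 0 < W y"
  shows "(x \<longlongrightarrow> a) at_top"
proof -
  define V where "V t = (dist (x t) a)\<^sup>2" for t
  have V: "V = (\<lambda>t. (x t - a) \<bullet> (x t - a))" by (rule ext) (simp add: V_def dist_norm power2_norm_eq_inner)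
  have dV: "(V has_derivative (\<lambda>h. h * (2 * ((x t - a) \<bullet> x' t)))) (at t within {0..})" if "t \<ge> 0" for t
    using deriv[OF that] unfolding V has_vector_derivative_def
    by (auto intro!: derivative_eq_intros simp: inner_commute algebra_simps)
  have mvt: "V t \<le> V s - m * (t - s)"
    if "0 \<le> s" "s < t" and m: "\<And>u. u \<ge> 0 \<Longrightarrow> m \<le> 2 * W (x u)" for s t m
  proof -
    have "\<exists>u\<in>{s<..<t}. V t - V s = (t - s) * (2 * ((x u - a) \<bullet> x' u))"
      using that by (intro mvt_simple has_derivative_subset[OF dV]) auto
    then obtain u where u: "s < u" "u < t" "V t - V s = (t - s) * (2 * ((x u - a) \<bullet> x' u))" by auto
    have "2 * ((x u - a) \<bullet> x' u) \<le> - m" using decay[of u] m[of u] u that(1) by linarith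
    then have "(t - s) * (2 * ((x u - a) \<bullet> x' u)) \<le> (t - s) * (- m)"
      using that by (intro mult_left_mono) auto
    with u(3) show ?thesis by (simp add: algebra_simps)
  qed
  have "0 \<le> W y" for y
  proof (cases "y = a")
    case True
    have "(W \<longlongrightarrow> W a) (at a)" using cont by (auto simp: continuous_on_def)
    moreover have "\<forall>\<^sub>F y in at a. 0 \<le> W y"
      using pos by (auto simp: eventually_at_filter less_imp_le)
    ultimately show ?thesis using True tendsto_lowerbound[of W "W a" "at a" 0] by simp
  qed (use pos in force)
  then have decr: "V t \<le> V s" if "0 \<le> s" "s \<le> t" for s t
    using mvt[of s t 0] that by (cases "s = t") auto
  have "\<exists>T\<ge>0. dist (x T) a < \<epsilon>" if "\<epsilon> > 0" for \<epsilon>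
  proof (rule ccontr)
    assume "\<not> ?thesis"
    then have far: "\<epsilon> \<le> dist (x t) a" if "t \<ge> 0" for t using that by force
    define K where "K = cball a (dist (x 0) a) - ball a \<epsilon>"
    have xK: "x t \<in> K" if "t \<ge> 0" for t
    proof -
      have "dist (x t) a \<le> dist (x 0) a"
        using decr[of 0 t] that by (auto simp: V_def intro: power2_le_imp_le)
      then show ?thesis using far[OF that] by (simp add: K_def dist_commute)
    qed
    have "compact K" by (simp add: K_def compact_diff)
    moreover have "K \<noteq> {}" using xK[of 0] by auto
    ultimately obtain y where y: "y \<in> K" "\<And>z. z \<in> K \<Longrightarrow> W y \<le> W z"
      using continuous_attains_inf[of K W] continuous_on_subset[OF cont] by blast
    have "y \<noteq> a" using y(1) that by (auto simp: K_def)
    then have "W y > 0" by (rule pos)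
    \<comment> \<open>A time after which a decay at rate \<open>W y\<close> has used up all of \<open>V 0\<close>.\<close>
    define T where "T = V 0 / W y + 1"
    have "V 0 \<ge> 0" by (simp add: V_def)
    then have "T > 0" using \<open>W y > 0\<close> by (simp add: T_def add_nonneg_pos)
    have "V T \<le> V 0 - W y * (T - 0)"
    proof (rule mvt)
      show "W y \<le> 2 * W (x u)" if "u \<ge> 0" for u
        using y(2)[OF xK[OF that]] \<open>W y > 0\<close> by linarith
    qed (use \<open>T > 0\<close> in auto)
    also have "\<dots> = - W y" using \<open>W y > 0\<close> by (simp add: T_def field_simps)
    finally have "V T < 0" using \<open>W y > 0\<close> by simp
    then show False by (simp add: V_def)
  qed
  note near = this
  show ?thesis
  proof (rule tendstoI)
    fix \<epsilon> :: real assume "\<epsilon> > 0"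
    from near[OF this] obtain T where T: "T \<ge> 0" "dist (x T) a < \<epsilon>" by auto
    have "dist (x t) a < \<epsilon>" if "t \<ge> T" for t
    proof -
      have "dist (x t) a \<le> dist (x T) a"
        using decr[of T t] that T by (auto simp: V_def intro: power2_le_imp_le)
      then show ?thesis using T by simp
    qed
    then show "\<forall>\<^sub>F t in at_top. dist (x t) a < \<epsilon>"
      unfolding eventually_at_top_linorder by blast
  qed
qed

theorem theorem3p7:
  fixes N :: nat and X bg :: "nat \<Rightarrow> real ^ 'd" and xg :: "real ^ 'd"
    and f :: "real \<Rightarrow> real" and f' :: "real \<Rightarrow> ereal" and x :: "real \<Rightarrow> real ^ 'd"
  assumes "home_location N X bg xg"
    and "consistent N X bg" and "nondegenerate N X bg"
    and "reshaping_function f f'"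
    and "gradient_trajectory (- X ` {1..N}) (cost N X bg f) x"
  shows "(x \<longlongrightarrow> xg) at_top"
proof -
  note home = assms(1) and nondeg = assms(3) and rf = assms(4)
  from assms(5) obtain g where g: "\<And>t. t \<ge> 0 \<Longrightarrow> x t \<notin> X ` {1..N}"
    "\<And>t. t \<ge> 0 \<Longrightarrow> GDERIV (cost N X bg f) (x t) :> g t"
    "\<And>t. t \<ge> 0 \<Longrightarrow> (x has_vector_derivative - g t) (at t within {0..})"
    unfolding gradient_trajectory_def by (metis ComplD)
  show ?thesis
  proof (rule converges_if_radially_decaying[where W = "cost N X bg f" and x' = "\<lambda>t. - g t"])
    show "(x t - xg) \<bullet> - g t \<le> - cost N X bg f (x t)" if "t \<ge> 0" for t
      using cost_le_radial_gradient[OF rf home g(1)[OF that] g(2)[OF that]] by simp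
  qed (use g(3) continuous_on_cost[OF rf home] cost_pos[OF rf home nondeg] in auto)
qed

end
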